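(* Consider pricing systems with Poisson arrivals, with the arrival rate $\lambda>0$, the service rate $\mu>0$ and the valuation distribution $G$ fixed, and varying number of servers $K\in\mathbb{N}$. Let $\theta^*(K)=\max_{\mathbf p\in\mathbb{R}_+^K}R(K,\mathbf p)$ be the optimal revenue rate and $(u_0^*(K),\dots,u_{K-1}^*(K))$ an optimal price vector of the $K$-server system. Then: (a) $\theta^*(K)$ is (strictly) increasing in $K$; (b) $\theta^*(K)/K$ is (strictly) decreasing in $K$; (c) for each $i\in\mathbb{Z}_+$, the optimal price $u_i^*(K)$ is non-increasing in $K$ over $K>i$, i.e. $u_i^*(K')\le u_i^*(K)$ whenever $i<K<K'$.
   Context: Model: jobs arrive according to a Poisson process of rate $\lambda$ at a system of $K$ servers with no waiting room; service times are i.i.d. exponential with mean $1/\mu$; valuations are i.i.d., independent of everything else, positive, with continuous distribution function $G$ and finite mean; $\overline{G}(u)=P(V\ge u)$ for a generic valuation $V$. A price vector is $\mathbf p=(p_0,\dots,p_{K-1})\in\mathbb{R}_+^K$; a job finding $k\le K-1$ busy servers joins and pays $p_k$ iff its valuation is at least $p_k$; otherwise, or if all $K$ servers are busy, it leaves. The revenue rate $R(K,\mathbf p)=\lim_{t\to\infty}\mathbb{E}[\text{revenue in }[0,t]]/t$ equals $\sum_{k=0}^{K-1}\pi_k\,\lambda\,\overline{G}(p_k)\,p_k$, where, with $\rho=\lambda/\mu$, $\pi_k=\pi_0\frac{\rho^k}{k!}\prod_{j=0}^{k-1}\overline{G}(p_j)$ for $1\le k\le K$ and $\pi_0=\big[1+\sum_{k=1}^K\frac{\rho^k}{k!}\prod_{j=0}^{k-1}\overline{G}(p_j)\big]^{-1}$.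 An optimal price vector is a maximizer of $R(K,\cdot)$ over $\mathbb{R}_+^K$. Standing assumption: for each $K$ a finite optimal price vector exists. *)

theory Defs
  imports "HOL-Probability.Probability"
begin

(* M is the law of a generic valuation V; lam and mu are the arrival and service rates throughout. *)
definition tail :: "real measure \<Rightarrow> real \<Rightarrow> real" where
  "tail M u = measure M {u..}"

(* The set R_+^K, with K a natural number rather than a type. *)
definition price_vectors :: "nat \<Rightarrow> (nat \<Rightarrow> real) set" where
  "price_vectors K = {..<K} \<rightarrow>\<^sub>E {0..}"

(* Ratio of the stationary probabilities of k and of 0 busy servers in the birth-death process
   with birth rate lam * tail M (p k) and death rate k * mu in state k. *)
definition stat_weight :: "real \<Rightarrow> real \<Rightarrow> real measure \<Rightarrow> (nat \<Rightarrow> real) \<Rightarrow> nat \<Rightarrow> real" where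
  "stat_weight lam mu M p k = (lam / mu) ^ k / fact k * (\<Prod>j<k. tail M (p j))"

definition stat_prob :: "real \<Rightarrow> real \<Rightarrow> real measure \<Rightarrow> nat \<Rightarrow> (nat \<Rightarrow> real) \<Rightarrow> nat \<Rightarrow> real" where
  "stat_prob lam mu M K p k =
     inverse (1 + (\<Sum>j=1..K. stat_weight lam mu M p j)) * stat_weight lam mu M p k"

(* Long-run expected revenue per unit of time: in state k, jobs join at rate
   lam * tail M (p k) and each of them pays p k. *)
definition revenue_rate :: "real \<Rightarrow> real \<Rightarrow> real measure \<Rightarrow> nat \<Rightarrow> (nat \<Rightarrow> real) \<Rightarrow> real" where
  "revenue_rate lam mu M K p = (\<Sum>k<K. stat_prob lam mu M K p k * lam * tail M (p k) * p k)"

definition optimal_price_vector ::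
    "real \<Rightarrow> real \<Rightarrow> real measure \<Rightarrow> nat \<Rightarrow> (nat \<Rightarrow> real) \<Rightarrow> bool" where
  "optimal_price_vector lam mu M K p \<longleftrightarrow>
     p \<in> price_vectors K \<and>
     (\<forall>q \<in> price_vectors K. revenue_rate lam mu M K q \<le> revenue_rate lam mu M K p)"

(* This is the maximum whenever an optimal price vector exists. *)
definition opt_revenue :: "real \<Rightarrow> real \<Rightarrow> real measure \<Rightarrow> nat \<Rightarrow> real" where
  "opt_revenue lam mu M K = (SUP p \<in> price_vectors K. revenue_rate lam mu M K p)"

end

theory Submission
  imports Defs
begin

text \<open>
  Let \<open>\<theta>\<close> be the optimal revenue rate and \<open>D k\<close> the opportunity cost of passing from \<open>k\<close> to
  \<open>k + 1\<close> busy servers. With \<open>\<phi> d = sup u. lam * tail M u * (u - d)\<close>, the optimality equations read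
  \<open>\<phi> (D k) = \<theta> - k * mu * D (k - 1)\<close> for \<open>k < K\<close>, together with \<open>K * mu * D (K - 1) = \<theta>\<close>.
  As \<open>\<phi>\<close> is strictly decreasing at the costs that occur, these equations can be compared between
  different states and different systems. One further server, priced at the largest price in use,
  raises \<open>\<theta>\<close>, hence lowers every \<open>D k\<close> by induction on \<open>k\<close>, hence lowers every price.
  Moreover \<open>D\<close> is increasing in \<open>k\<close>; if \<open>\<theta> / K\<close> were not decreasing, comparing state \<open>k\<close> of the
  \<open>K\<close>-server system with state \<open>k + m\<close> of the \<open>(K + m)\<close>-server system would
  yield \<open>D (K - 1) > D' (K + m - 1)\<close>, contradicting the boundary equations.
\<close>

locale pricing =
  fixes lam mu :: real and M :: "real measure"
  assumes lam_pos: "lam > 0" and mu_pos: "mu > 0"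
    and distr: "real_distribution M"
    and valuation_pos: "AE v in M. v > 0"
begin

abbreviation "G \<equiv> tail M"
abbreviation "w \<equiv> stat_weight lam mu M"
abbreviation "R \<equiv> revenue_rate lam mu M"

section \<open>The tail of the valuation law\<close>

lemma tail_nonneg: "G x \<ge> 0"
  by (simp add: tail_def)

lemma tail_antimono: "x \<le> y \<Longrightarrow> G y \<le> G x"
proof -
  interpret real_distribution M by (rule distr)
  show "x \<le> y \<Longrightarrow> G y \<le> G x"
    unfolding tail_def by (intro finite_measure_mono) auto
qed

lemma ex_tail_pos: "\<exists>x>0. G x > 0"
proof (rule ccontr)
  interpret real_distribution M by (rule distr)
  assume neg: "\<not> (\<exists>x>0. G x > 0)"
  have "measure M {x..} = 0" if "x > 0" for x
  proof -
    have "G x \<le> 0" using neg that by (meson not_less)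
    with tail_nonneg[of x] have "G x = 0" by (rule order_antisym[rotated])
    then show ?thesis by (simp add: tail_def)
  qed
  \<comment> \<open>Countably many of these half-lines exhaust the positive reals.\<close>
  then have "AE v in M. v \<notin> {inverse (real (Suc n))..}" for n
    by (intro AE_not_in) (auto simp: null_sets_def emeasure_eq_measure)
  then have "AE v in M. \<forall>n. v \<notin> {inverse (real (Suc n))..}"
    by (simp add: AE_all_countable)
  with valuation_pos have "AE v in M. False"
  proof eventually_elim
    case (elim v)
    then obtain n where "inverse (real (Suc n)) < v"
      using reals_Archimedean by blast
    with elim show ?case by (metis atLeast_iff less_imp_le)
  qed
  then show False by simp
qed

section \<open>Stationary weights and the revenue rate\<close>

lemma w_0: "w p 0 = 1"
  by (simp add: stat_weight_def)

text \<open>Flow balance across the cut between \<open>k\<close> and \<open>Suc k\<close>.\<close>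

lemma w_Suc: "w p (Suc k) * (real (Suc k) * mu) = w p k * lam * G (p k)"
proof -
  have "w p (Suc k) = w p k * (lam / mu * G (p k) / real (Suc k))"
    unfolding stat_weight_def by (simp add: field_simps del: of_nat_Suc)
  then show ?thesis
    using mu_pos by (simp del: of_nat_Suc)
qed

lemma w_nonneg: "w p k \<ge> 0"
  unfolding stat_weight_def using lam_pos mu_pos tail_nonneg
  by (intro mult_nonneg_nonneg divide_nonneg_nonneg prod_nonneg) auto

lemma w_pos_iff: "w p k > 0 \<longleftrightarrow> (\<forall>j<k. G (p j) > 0)"
proof -
  have "w p k \<noteq> 0 \<longleftrightarrow> (\<forall>j<k. G (p j) \<noteq> 0)"
    unfolding stat_weight_def using lam_pos mu_pos by auto
  then show ?thesis
    using w_nonneg[of p k] tail_nonneg by (metis order_le_less)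
qed

lemma w_cong: "(\<And>j. j < k \<Longrightarrow> p j = q j) \<Longrightarrow> w p k = w q k"
  unfolding stat_weight_def by simp

definition income :: "nat \<Rightarrow> (nat \<Rightarrow> real) \<Rightarrow> real" where
  "income K p = (\<Sum>k<K. w p k * lam * G (p k) * p k)"

definition norm_const :: "nat \<Rightarrow> (nat \<Rightarrow> real) \<Rightarrow> real" where
  "norm_const K p = (\<Sum>k\<le>K. w p k)"

lemma norm_const_pos: "norm_const K p > 0"
proof -
  have "w p 0 \<le> norm_const K p"
    unfolding norm_const_def by (intro member_le_sum w_nonneg) auto
  then show ?thesis by (simp add: w_0)
qed

lemma R_eq: "R K p = income K p / norm_const K p"
proof -
  have "norm_const K p = 1 + (\<Sum>j=1..K. w p j)"
    unfolding norm_const_def atMost_atLeast0 by (simp add: sum.atLeast_Suc_atMost w_0)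
  then show ?thesis
    by (simp add: revenue_rate_def stat_prob_def income_def sum_divide_distrib field_simps)
qed

lemma less_R_iff: "t < R K p \<longleftrightarrow> t * norm_const K p < income K p"
  by (simp add: R_eq pos_less_divide_eq norm_const_pos)

lemma R_cong:
  assumes "\<And>j. j < K \<Longrightarrow> p j = q j"
  shows "R K p = R K q"
proof -
  have "w p k = w q k" if "k \<le> K" for k
    using assms that by (intro w_cong) simp
  with assms show ?thesis
    by (simp add: R_eq income_def norm_const_def)
qed

text \<open>Nobody joins in state \<open>m\<close>, so all states above it have weight 0.\<close>

lemma R_truncate:
  assumes "G (p m) = 0" "m \<le> K"
  shows "R K p = R m p"
proof -
  have w0: "w p k = 0" if "m < k" for k
    unfolding stat_weight_def using that assms(1) by auto
  then have "norm_const K p = norm_const m p"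
    unfolding norm_const_def using assms(2) by (intro sum.mono_neutral_right) auto
  moreover have "w p k * lam * G (p k) * p k = 0" if "m \<le> k" for k
    using w0[of k] assms(1) that by (cases "k = m") auto
  then have "income K p = income m p"
    unfolding income_def using assms(2) by (intro sum.mono_neutral_right) auto
  ultimately show ?thesis by (simp add: R_eq)
qed

text \<open>With \<open>x\<close> at least every price in use, balance bounds the old rate by
  \<open>real K * mu * x\<close>. The new state \<open>Suc K\<close> brings in
  \<open>real (Suc K) * mu * x\<close> per unit of its weight and so raises the average.\<close>

lemma R_Suc_gt:
  assumes "w p K > 0"
  obtains x where "x > 0" "R (Suc K) (p(K := x)) > R K p"
proof -
  obtain x0 where x0: "x0 > 0" "G x0 > 0" using ex_tail_pos by blast
  \<comment> \<open>\<open>x0\<close> keeps \<open>x\<close> positive even if \<open>K = 0\<close>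
    or all prices are 0. The maximum is attained, so \<open>G x > 0\<close>.\<close>
  define x where "x = Max (insert x0 (p ` {..<K}))"
  have x_pos: "x > 0"
    using x0(1) unfolding x_def by (rule less_le_trans) (intro Max_ge, auto)
  have p_le: "p k \<le> x" if "k < K" for k
    using that by (simp add: x_def)
  have "x \<in> insert x0 (p ` {..<K})"
    unfolding x_def by (intro Max_in) auto
  then have Gx: "G x > 0"
    using assms x0 by (auto simp: w_pos_iff)
  let ?q = "p(K := x)"
  have w_eq: "w ?q k = w p k" if "k \<le> K" for k
    using that by (intro w_cong) simp
  have inc: "income (Suc K) ?q = income K p + w p K * lam * G x * x"
    by (simp add: income_def w_eq)
  have nrm: "norm_const (Suc K) ?q = norm_const K p + w ?q (Suc K)"
    by (simp add: norm_const_def w_eq)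
  have "income K p \<le> (\<Sum>k<K. w p (Suc k) * (real K * mu * x))"
    unfolding income_def
  proof (intro sum_mono)
    fix k assume k: "k \<in> {..<K}"
    have "w p k * lam * G (p k) * p k \<le> w p k * lam * G (p k) * x"
      using k p_le w_nonneg lam_pos tail_nonneg by (intro mult_left_mono) auto
    also have "\<dots> = w p (Suc k) * (real (Suc k) * mu * x)"
      unfolding w_Suc[symmetric] by simp
    also have "\<dots> \<le> w p (Suc k) * (real K * mu * x)"
      using k x_pos mu_pos w_nonneg by (intro mult_left_mono mult_right_mono) auto
    finally show "w p k * lam * G (p k) * p k \<le> w p (Suc k) * (real K * mu * x)" .
  qed
  also have "\<dots> = (\<Sum>k<K. w p (Suc k)) * (real K * mu * x)"
    by (simp add: sum_distrib_right)
  also have "\<dots> \<le> norm_const K p * (real K * mu * x)"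
  proof (intro mult_right_mono)
    show "(\<Sum>k<K. w p (Suc k)) \<le> norm_const K p"
      unfolding norm_const_def sum.atMost_shift using w_nonneg by simp
  qed (use x_pos mu_pos in auto)
  finally have "R K p \<le> real K * mu * x"
    by (simp add: R_eq pos_divide_le_eq norm_const_pos mult.commute)
  also have "\<dots> < real (Suc K) * mu * x"
    using x_pos mu_pos by simp
  finally have R_less: "R K p < real (Suc K) * mu * x" .
  have wS: "w ?q (Suc K) * (real (Suc K) * mu) = w p K * lam * G x"
    using w_Suc[of ?q K] w_eq by simp
  have "w ?q (Suc K) > 0"
    using assms Gx by (auto simp: w_pos_iff less_Suc_eq)
  then have "R K p * w ?q (Suc K) < w p K * lam * G x * x"
    unfolding wS[symmetric] using R_less by (simp add: mult_ac del: of_nat_Suc)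
  moreover have "R K p * norm_const K p = income K p"
    using norm_const_pos[of K p] by (simp add: R_eq)
  ultimately have "R K p < R (Suc K) ?q"
    unfolding less_R_iff inc nrm by (simp add: algebra_simps)
  with that x_pos show ?thesis by blast
qed

text \<open>By \<open>w_Suc\<close> the terms in \<open>D\<close> telescope, for arbitrary
  \<open>D\<close> and \<open>t\<close>. At an optimal vector this yields the boundary equation, at
  a vector changed in one state the optimality inequality there.\<close>

lemma performance_difference:
  "(\<Sum>k<K. w q k * (lam * G (q k) * (q k - D k) + real k * mu * D (k - 1) - t))
     + w q K * (real K * mu * D (K - 1) - t) = income K q - t * norm_const K q"
proof (induction K)
  case 0
  show ?case by (simp add: income_def norm_const_def)
next
  case (Suc K)
  have "w q (Suc K) * (real (Suc K) * mu * D K) = w q K * lam * G (q K) * D K"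
    using w_Suc[of q K] by (metis mult.assoc)
  with Suc show ?case
    by (simp add: income_def norm_const_def algebra_simps del: of_nat_Suc)
qed

section \<open>Optimal price vectors\<close>

abbreviation "optimal \<equiv> optimal_price_vector lam mu M"

lemma optimal_nonneg: "optimal K p \<Longrightarrow> k < K \<Longrightarrow> p k \<ge> 0"
  by (auto simp: optimal_price_vector_def price_vectors_def)

lemma optimal_ge:
  assumes "optimal K p" "\<And>k. k < K \<Longrightarrow> q k \<ge> 0"
  shows "R K q \<le> R K p"
proof -
  have "R K (restrict q {..<K}) \<le> R K p"
    using assms by (auto simp: optimal_price_vector_def price_vectors_def)
  moreover have "R K (restrict q {..<K}) = R K q"
    by (intro R_cong) simp
  ultimately show ?thesis by simp
qed

lemma opt_revenue_eq: "optimal K p \<Longrightarrow> opt_revenue lam mu M K = R K p"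
  unfolding opt_revenue_def optimal_price_vector_def
  by (intro cSup_eq_maximum) auto

text \<open>If \<open>m\<close> is the first state that admits nobody, the system amounts to one
  with \<open>m\<close> servers, and \<open>R_Suc_gt\<close> shows that admitting jobs in state
  \<open>m\<close> pays.\<close>

lemma optimal_tail_pos:
  assumes opt: "optimal K p" and k: "k < K"
  shows "G (p k) > 0"
proof (rule ccontr)
  assume "\<not> G (p k) > 0"
  then have Gk: "G (p k) = 0" using tail_nonneg[of "p k"] by simp
  define m where "m = (LEAST j. G (p j) = 0)"
  have m: "G (p m) = 0" "m \<le> k" and "\<And>j. j < m \<Longrightarrow> G (p j) \<noteq> 0"
    unfolding m_def using LeastI[of "\<lambda>j. G (p j) = 0", OF Gk]
      Least_le[of "\<lambda>j. G (p j) = 0", OF Gk] not_less_Least by blast+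
  then have "w p m > 0"
    using tail_nonneg unfolding w_pos_iff by (simp add: order_less_le)
  then obtain x where x: "x > 0" "R (Suc m) (p(m := x)) > R m p"
    by (rule R_Suc_gt)
  \<comment> \<open>Above \<open>m\<close> the prohibitive price \<open>p m\<close> leaves the
    equivalent of \<open>Suc m\<close> servers.\<close>
  define q where "q j = (if j < m then p j else if j = m then x else p m)" for j
  have "R K q = R (Suc m) q"
    by (rule R_truncate) (use m k in \<open>auto simp: q_def\<close>)
  also have "\<dots> = R (Suc m) (p(m := x))"
    by (intro R_cong) (auto simp: q_def)
  also have "\<dots> > R m p" by (rule x)
  also have "R m p = R K p"
    using m k by (intro R_truncate[symmetric]) auto
  finally have "R K q > R K p" .
  moreover have "R K q \<le> R K p"
    using opt
  proof (rule optimal_ge)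
    show "q j \<ge> 0" if "j < K" for j
      using that x m k optimal_nonneg[OF opt] by (auto simp: q_def)
  qed
  ultimately show False by simp
qed

lemma optimal_less_Suc:
  assumes "optimal K p" "optimal (Suc K) q"
  shows "R K p < R (Suc K) q"
proof -
  have "w p K > 0"
    using optimal_tail_pos[OF assms(1)] by (simp add: w_pos_iff)
  then obtain x where x: "x > 0" "R (Suc K) (p(K := x)) > R K p"
    by (rule R_Suc_gt)
  moreover have "R (Suc K) (p(K := x)) \<le> R (Suc K) q"
    using assms(2)
    by (rule optimal_ge) (use x optimal_nonneg[OF assms(1)] in auto)
  ultimately show ?thesis by simp
qed

lemma optimal_R_pos:
  assumes "optimal K p" "K \<ge> 1"
  shows "R K p > 0"
proof -
  obtain x where x: "x > 0" "G x > 0" using ex_tail_pos by blast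
  have w: "w (\<lambda>_. x) k > 0" for k
    using x by (simp add: w_pos_iff)
  have "income K (\<lambda>_. x) > 0"
    unfolding income_def
  proof (rule sum_pos)
    show "{..<K} \<noteq> {}" using assms(2) by (simp add: lessThan_empty_iff)
    show "w (\<lambda>_. x) k * lam * G x * x > 0" for k
      using w lam_pos x by (intro mult_pos_pos)
  qed simp
  then have "0 < R K (\<lambda>_. x)"
    by (simp add: less_R_iff)
  also have "\<dots> \<le> R K p"
    using assms(1) by (rule optimal_ge) (use x in simp)
  finally show ?thesis .
qed

section \<open>Optimality equations\<close>

text \<open>The argument \<open>t\<close> is the revenue rate. For \<open>k = 0\<close> the truncated index in \<open>D (k - 1)\<close> is
  harmless, as the term carries the factor \<open>k\<close>.\<close>

definition bellman :: "nat \<Rightarrow> (nat \<Rightarrow> real) \<Rightarrow> real \<Rightarrow> (nat \<Rightarrow> real) \<Rightarrow> bool" where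
  "bellman K p t D \<longleftrightarrow>
     (\<forall>k<K. p k \<ge> 0 \<and> G (p k) > 0 \<and>
        lam * G (p k) * (p k - D k) = t - real k * mu * D (k - 1) \<and>
        (\<forall>x\<ge>0. lam * G x * (x - D k) \<le> t - real k * mu * D (k - 1))) \<and>
     real K * mu * D (K - 1) = t"

lemma bellmanD:
  assumes "bellman K p t D"
  shows "k < K \<Longrightarrow> p k \<ge> 0" "k < K \<Longrightarrow> G (p k) > 0"
    "k < K \<Longrightarrow> lam * G (p k) * (p k - D k) = t - real k * mu * D (k - 1)"
    "k < K \<Longrightarrow> x \<ge> 0 \<Longrightarrow> lam * G x * (x - D k) \<le> t - real k * mu * D (k - 1)"
    "real K * mu * D (K - 1) = t"
  using assms by (auto simp: bellman_def)

lemma optimal_imp_bellman: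
  assumes opt: "optimal K p"
  obtains D where "bellman K p (R K p) D"
proof -
  define t where "t = R K p"
  \<comment> \<open>The equation at the price \<open>p k\<close> is solved for \<open>D k\<close>,
    going up from state 0, so the equalities hold by construction.\<close>
  define D where "D = rec_nat (p 0 - t / (lam * G (p 0)))
    (\<lambda>k d. p (Suc k) - (t - real (Suc k) * mu * d) / (lam * G (p (Suc k))))"
  have D_rec: "D k = p k - (t - real k * mu * D (k - 1)) / (lam * G (p k))" for k
    by (cases k) (simp_all add: D_def)
  have Gp: "G (p k) > 0" if "k < K" for k
    using optimal_tail_pos[OF opt that] .
  have eq: "lam * G (p k) * (p k - D k) = t - real k * mu * D (k - 1)" if "k < K" for k
    by (subst (1) D_rec) (use Gp[OF that] lam_pos in simp)
  have wK: "w p K > 0"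
    using Gp by (simp add: w_pos_iff)
  have "(\<Sum>k<K. w p k * (lam * G (p k) * (p k - D k) + real k * mu * D (k - 1) - t)) = 0"
    using eq by (intro sum.neutral) simp
  then have "w p K * (real K * mu * D (K - 1) - t) = income K p - t * norm_const K p"
    using performance_difference[of p D t K] by simp
  also have "\<dots> = 0"
    using norm_const_pos[of K p] by (simp add: t_def R_eq)
  finally have bd: "real K * mu * D (K - 1) = t"
    using wK by simp
  have "lam * G x * (x - D k) \<le> t - real k * mu * D (k - 1)" if k: "k < K" and x: "x \<ge> 0" for k x
  proof -
    \<comment> \<open>Only state \<open>k\<close> is changed: all other summands vanish, and the
      weight of \<open>k\<close>, which depends on the prices in lower states alone, stays
      positive.\<close>
    define q where "q = p(k := x)"
    define B where "B j = lam * G (q j) * (q j - D j) + real j * mu * D (j - 1) - t" for j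
    have B0: "B j = 0" if "j < K" "j \<noteq> k" for j
      using eq[OF that(1)] that(2) by (simp add: B_def q_def)
    have "w q k = w p k"
      by (intro w_cong) (simp add: q_def)
    then have wk: "w q k > 0"
      using Gp k by (auto simp: w_pos_iff)
    have "(\<Sum>j<K. w q j * B j) = (\<Sum>j\<in>{k}. w q j * B j)"
      using B0 k by (intro sum.mono_neutral_right) auto
    then have "w q k * B k = income K q - t * norm_const K q"
      using performance_difference[of q D t K] bd by (simp add: B_def)
    also have "\<dots> \<le> 0"
    proof -
      have "\<not> t < R K q"
        using optimal_ge[OF opt, of q] optimal_nonneg[OF opt] x
        by (auto simp: t_def q_def not_less)
      then show ?thesis by (simp add: less_R_iff)
    qed
    finally have "B k \<le> 0"
      using wk by (simp add: mult_le_0_iff)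
    then show ?thesis by (simp add: B_def q_def)
  qed
  with eq bd Gp optimal_nonneg[OF opt] have "bellman K p t D"
    by (auto simp: bellman_def)
  with that show ?thesis by (simp add: t_def)
qed

section \<open>Comparison of opportunity costs\<close>

text \<open>The price \<open>p' j\<close> is a candidate in state \<open>k\<close>. This is the
  subgradient inequality of the convex \<open>\<phi>\<close> at \<open>D' j\<close>, with slope
  \<open>- lam * G (p' j)\<close>.\<close>

lemma bellman_gain:
  assumes "bellman K p t D" "bellman K' p' t' D'" "k < K" "j < K'"
  shows "t' - real j * mu * D' (j - 1) + lam * G (p' j) * (D' j - D k) \<le> t - real k * mu * D (k - 1)"
  using bellmanD(4)[OF assms(1,3), of "p' j"] bellmanD(1,3)[OF assms(2,4)]
  by (simp add: algebra_simps)

text \<open>That slope is strictly negative, so a larger value of \<open>\<phi>\<close> forces a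
  smaller cost. Both systems may be the same one.\<close>

lemma bellman_cost_le:
  assumes "bellman K p t D" "bellman K' p' t' D'" "k < K" "j < K'"
    and "t - real k * mu * D (k - 1) \<le> t' - real j * mu * D' (j - 1)"
  shows "D' j \<le> D k"
proof (rule ccontr)
  assume "\<not> D' j \<le> D k"
  then have "lam * G (p' j) * (D' j - D k) > 0"
    using lam_pos bellmanD(2)[OF assms(2,4)] by simp
  with bellman_gain[OF assms(1-4)] assms(5) show False by simp
qed

lemma bellman_cost_less:
  assumes "bellman K p t D" "bellman K' p' t' D'" "k < K" "j < K'"
    and less: "t - real k * mu * D (k - 1) < t' - real j * mu * D' (j - 1)"
  shows "D' j < D k"
proof -
  have "D' j \<noteq> D k"
    using bellman_gain[OF assms(1-4)] less by auto
  with bellman_cost_le[OF assms(1-4)] less show ?thesis by simp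
qed

text \<open>Otherwise comparison with state 0 keeps every cost nonpositive, by induction, against
  the boundary equation.\<close>

lemma bellman_cost_pos:
  assumes b: "bellman K p t D" and "K \<ge> 1" "t > 0"
  shows "D 0 > 0"
proof (rule ccontr)
  assume neg: "\<not> D 0 > 0"
  have "k < K \<longrightarrow> D k \<le> 0" for k
  proof (induction k)
    case 0
    then show ?case using neg by simp
  next
    case (Suc k)
    show ?case
    proof
      assume k: "Suc k < K"
      then have "real (Suc k) * mu * D k \<le> 0"
        using Suc mu_pos by (intro mult_nonneg_nonpos) auto
      then have "D (Suc k) \<le> D 0"
        using k by (intro bellman_cost_le[OF b b]) auto
      with neg show "D (Suc k) \<le> 0" by simp
    qed
  qed
  then have "real K * mu * D (K - 1) \<le> 0"
    using mu_pos \<open>K \<ge> 1\<close> by (intro mult_nonneg_nonpos) auto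
  with bellmanD(5)[OF b] \<open>t > 0\<close> show False by simp
qed

text \<open>Positive increasing costs make \<open>real k * mu * D (k - 1)\<close> grow with
  \<open>k\<close>, so \<open>\<phi> (D k)\<close> falls. Positivity is therefore carried through
  the induction.\<close>

lemma bellman_cost_strict_mono:
  assumes b: "bellman K p t D" and "t > 0" and "i < j" "j < K"
  shows "D i < D j"
proof -
  have Suc_less: "Suc k < K \<longrightarrow> 0 < D k \<and> D k < D (Suc k)" for k
  proof (induction k)
    case 0
    show ?case
    proof
      assume K: "Suc 0 < K"
      then have pos: "D 0 > 0"
        using bellman_cost_pos[OF b] \<open>t > 0\<close> by simp
      moreover have "D 0 < D (Suc 0)"
        using K pos mu_pos by (intro bellman_cost_less[OF b b]) auto
      ultimately show "0 < D 0 \<and> D 0 < D (Suc 0)" by simp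
    qed
  next
    case (Suc k)
    show ?case
    proof
      assume K: "Suc (Suc k) < K"
      with Suc have D: "0 < D k" "D k < D (Suc k)" by auto
      then have "real (Suc k) * mu * D k < real (Suc (Suc k)) * mu * D (Suc k)"
        using mu_pos by (intro mult_strict_mono mult_strict_right_mono) auto
      then have "D (Suc k) < D (Suc (Suc k))"
        using K by (intro bellman_cost_less[OF b b]) auto
      with D show "0 < D (Suc k) \<and> D (Suc k) < D (Suc (Suc k))" by simp
    qed
  qed
  show ?thesis
    using \<open>i < j\<close> \<open>j < K\<close>
  proof (induction rule: strict_inc_induct)
    case (base i)
    then show ?case using Suc_less[of i] by simp
  next
    case (step i)
    then show ?case using Suc_less[of i] by simp
  qed
qed

text \<open>The larger rate and the smaller preceding cost both raise
  \<open>\<phi> (D' k)\<close>.\<close>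

lemma bellman_cost_antimono_rate:
  assumes b: "bellman K p t D" and b': "bellman K' p' t' D'"
    and "t < t'" "k < K" "k < K'"
  shows "D' k < D k"
  using \<open>k < K\<close> \<open>k < K'\<close>
proof (induction k)
  case 0
  then show ?case
    using \<open>t < t'\<close> by (intro bellman_cost_less[OF b b']) auto
next
  case (Suc k)
  then have "D' k < D k" by simp
  then have "real (Suc k) * mu * D' k < real (Suc k) * mu * D k"
    using mu_pos by simp
  then have "t - real (Suc k) * mu * D k < t' - real (Suc k) * mu * D' k"
    using \<open>t < t'\<close> by linarith
  with Suc.prems show ?case
    by (intro bellman_cost_less[OF b b']) auto
qed

section \<open>Prices and revenue per server\<close>

text \<open>Adding the optimality inequalities of both prices shows that the lower cost goes with at
  least as large a tail.\<close>

lemma bellman_price_antimono_rate: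
  assumes b: "bellman K p t D" and b': "bellman K' p' t' D'"
    and "t < t'" and k: "k < K" "k < K'"
  shows "p' k \<le> p k"
proof (rule ccontr)
  assume less: "\<not> p' k \<le> p k"
  let ?d = "D k" and ?d' = "D' k" and ?g = "G (p k)" and ?g' = "G (p' k)"
  have d: "?d' < ?d"
    by (rule bellman_cost_antimono_rate[OF assms])
  have "lam * (?g' * (p' k - ?d)) \<le> lam * (?g * (p k - ?d))"
    using bellmanD(3)[OF b k(1)] bellmanD(4)[OF b k(1), of "p' k"] bellmanD(1)[OF b' k(2)]
    by (simp add: mult.assoc)
  then have 1: "?g' * (p' k - ?d) \<le> ?g * (p k - ?d)"
    using lam_pos by simp
  have "lam * (?g * (p k - ?d')) \<le> lam * (?g' * (p' k - ?d'))"
    using bellmanD(3)[OF b' k(2)] bellmanD(4)[OF b' k(2), of "p k"] bellmanD(1)[OF b k(1)]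
    by (simp add: mult.assoc)
  then have 2: "?g * (p k - ?d') \<le> ?g' * (p' k - ?d')"
    using lam_pos by simp
  have "?g * (?d - ?d') \<le> ?g' * (?d - ?d')"
    using 1 2 by (simp add: algebra_simps)
  then have "?g \<le> ?g'" using d by simp
  \<comment> \<open>With equal positive tails, the higher price \<open>p' k\<close> would beat
    \<open>p k\<close> at cost \<open>D k\<close>.\<close>
  with tail_antimono[of "p k" "p' k"] less have "?g' = ?g" by simp
  with 1 less bellmanD(2)[OF b k(1)] show False by simp
qed

text \<open>The systems are aligned at the full end: states \<open>k\<close> and
  \<open>k + m\<close> have the same number of idle servers.\<close>

lemma bellman_rate_per_server:
  assumes b: "bellman K p t D" and b': "bellman K' p' t' D'"
    and "K \<ge> 1" "K < K'" "t' > 0"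
  shows "t' / real K' < t / real K"
proof (rule ccontr)
  assume "\<not> t' / real K' < t / real K"
  \<comment> \<open>The boundary equation gives \<open>c = t' / (real K' * mu)\<close>, so the
    negated claim reads \<open>t \<le> real K * mu * c\<close>.\<close>
  define c where "c = D' (K' - 1)"
  have t': "t' = real K' * mu * c"
    using bellmanD(5)[OF b'] by (simp add: c_def)
  have "t / real K \<le> mu * c"
    using \<open>\<not> t' / real K' < t / real K\<close> \<open>K < K'\<close> by (simp add: t')
  then have t: "t \<le> real K * mu * c"
    using \<open>K \<ge> 1\<close> by (simp add: field_simps)
  define m where "m = K' - K"
  have K': "K' = K + m" "m \<ge> 1" using \<open>K < K'\<close> by (auto simp: m_def)
  have "k < K \<longrightarrow> D' (k + m) < D k" for k
  proof (induction k)
    case 0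
    show ?case
    proof
      assume "0 < K"
      then have "D' (m - 1) < c"
        unfolding c_def using K' by (intro bellman_cost_strict_mono[OF b' \<open>t' > 0\<close>]) auto
      then have "real m * mu * D' (m - 1) < real m * mu * c"
        using K' mu_pos by simp
      with t have "t < t' - real m * mu * D' (m - 1)"
        by (simp add: t' K' algebra_simps)
      then show "D' (0 + m) < D 0"
        using K' \<open>0 < K\<close> by (intro bellman_cost_less[OF b b']) auto
    qed
  next
    case (Suc k)
    show ?case
    proof
      assume k: "Suc k < K"
      \<comment> \<open>The factor \<open>Suc k + m\<close> is split: the part \<open>Suc k\<close>
        is handled by the induction hypothesis, the part \<open>m\<close> by
        \<open>D' (k + m) < c\<close>.\<close>
      have "real (Suc k) * mu * D' (k + m) < real (Suc k) * mu * D k"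
        using Suc k mu_pos by simp
      moreover have "D' (k + m) < c"
        unfolding c_def using K' k by (intro bellman_cost_strict_mono[OF b' \<open>t' > 0\<close>]) auto
      then have "real m * mu * D' (k + m) < real m * mu * c"
        using K' mu_pos by simp
      ultimately have "t - real (Suc k) * mu * D k < t' - real (Suc k + m) * mu * D' (k + m)"
        using t by (simp add: t' K' algebra_simps)
      then show "D' (Suc k + m) < D (Suc k)"
        using K' k by (intro bellman_cost_less[OF b b']) auto
    qed
  qed
  from this[of "K - 1"] have "c < D (K - 1)"
    using K' \<open>K \<ge> 1\<close> by (simp add: c_def)
  then have "real K * mu * c < real K * mu * D (K - 1)"
    using mu_pos \<open>K \<ge> 1\<close> by simp
  with t bellmanD(5)[OF b] show False by simp
qed

end

theorem proposition22:
  fixes lam mu :: real and M :: "real measure" and u :: "nat \<Rightarrow> nat \<Rightarrow> real"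
  assumes "lam > 0" and "mu > 0"
    and "real_distribution M"
    and "AE v in M. v > 0"
    and "continuous_on UNIV (cdf M)"
    and "integrable M (\<lambda>v. v)"
    and "\<And>K. K \<ge> 1 \<Longrightarrow> optimal_price_vector lam mu M K (u K)"
  shows "strict_mono_on {1..} (opt_revenue lam mu M) \<and>
    strict_antimono_on {1..} (\<lambda>K. opt_revenue lam mu M K / real K) \<and>
    (\<forall>i K K'. i < K \<and> K < K' \<longrightarrow> u K' i \<le> u K i)"
proof -
  interpret pricing lam mu M
    by (rule pricing.intro) (fact assms)+
  \<comment> \<open>The supremum is attained at \<open>u K\<close>, so \<open>T\<close> can replace
    it.\<close>
  define T where "T K = R K (u K)" for K
  have opt: "optimal K (u K)" if "K \<ge> 1" for K
    by (rule assms(7)[OF that])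
  have T: "opt_revenue lam mu M K = T K" if "K \<ge> 1" for K
    using opt_revenue_eq[OF opt[OF that]] by (simp add: T_def)
  have T_pos: "T K > 0" if "K \<ge> 1" for K
    using optimal_R_pos[OF opt[OF that] that] by (simp add: T_def)
  have bell: "\<exists>D. bellman K (u K) (T K) D" if "K \<ge> 1" for K
    using optimal_imp_bellman[OF opt[OF that]] unfolding T_def by blast
  have T_less: "T K < T K'" if "K \<ge> 1" "K < K'" for K K'
    using \<open>K < K'\<close>
  proof (induction K')
    case (Suc n)
    then have "T n < T (Suc n)"
      using optimal_less_Suc[of n "u n" "u (Suc n)"] opt \<open>K \<ge> 1\<close> by (simp add: T_def)
    with Suc show ?case
      by (cases "K = n") auto
  qed simp
  have "T K' / real K' < T K / real K" if "K \<ge> 1" "K < K'" for K K'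
  proof -
    obtain D D' where "bellman K (u K) (T K) D" "bellman K' (u K') (T K') D'"
      using bell[of K] bell[of K'] \<open>K \<ge> 1\<close> \<open>K < K'\<close> by auto
    then show ?thesis
      by (rule bellman_rate_per_server) (use that T_pos[of K'] in auto)
  qed
  moreover have "u K' i \<le> u K i" if "i < K" "K < K'" for i K K'
  proof -
    obtain D D' where "bellman K (u K) (T K) D" "bellman K' (u K') (T K') D'"
      using bell[of K] bell[of K'] \<open>i < K\<close> \<open>K < K'\<close> by auto
    then show ?thesis
      by (rule bellman_price_antimono_rate) (use that T_less[of K K'] in auto)
  qed
  ultimately show ?thesis
    using T_less by (auto simp: monotone_on_def T)
qed

end
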